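(* Let $m\le n^\gamma$ with $\gamma<2r$, let $d\asymp N_{\text{bass}}^{1/(1+2r)}$, fix $C_0\in\mathbb R$ and $\epsilon>0$, and consider a regression type model with log-likelihood ratios $W_{d,i}^{(k)}=W_d^{(k)}(X_i^{(k)},T_i^{(k)},\boldsymbol\beta,\boldsymbol\beta')$. Suppose that, for $\boldsymbol\beta\in\{-1,1\}^d$ and $\boldsymbol\beta'=-\boldsymbol\beta$: 1. $W_{d,i}^{(k)}=g_1(T_i^{(k)})h(X_i^{(k)})-g_2(T_i^{(k)})$ for some functions $g_1,g_2,h$. 2. The conditional distribution of $h(X_i^{(k)})$ given $T_i^{(k)}$ is sub-exponential: $h(X_i^{(k)})\mid T_i^{(k)}\sim SE\big(\nu^2(T_i^{(k)}),b(T_i^{(k)})\big)$. 3. $\max_{t\in[0,1]}\mathbb E[W_{d,i}^{(k)}\mid T_i^{(k)}=t]-\min_{t\in[0,1]}\mathbb E[W_{d,i}^{(k)}\mid T_i^{(k)}=t]=O(d^{-r})$, $\ \max_{t\in[0,1]}\nu^2(t)g_1^2(t)=O(d^{-2r})$, and $\max_{t\in[0,1]}g_1(t)b(t)=O(d^{-r})$. 4. $\mathbb E[W_{d,i}^{(k)}]=O(d^{-2r})$, and for some $c_1>0$, $c_1d^{-1-2r}\le\mathbb E\big[\nu^2(T_i^{(k)})g_1^2(T_i^{(k)})\mathbf 1_{T_i^{(k)}\in I_h}\big]$ for all $h\in\{1,\dots,d\}$. Then there is a constant $C>0$ such that, with $a_n=C\epsilon d^{-1/2-r}\sqrt{n\log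 N}$, the events $$E_h^{(k)}(a_n)=\Big\{(T^{(k)},X^{(k)}):\ \max_{\boldsymbol\beta,\boldsymbol\beta'\in\{-1,1\}^d}\ \sum_{i:\,T_i^{(k)}\in I_h}W_d^{(k)}(X_i^{(k)},T_i^{(k)},\boldsymbol\beta,\boldsymbol\beta')\le a_n\Big\}$$ satisfy $\mathbb P_{\beta_h}\big(E_h^{(k)}(a_n)\big)=1+o(m^{-2}d^{-2})$ for all $h\in\{1,\dots,d\}$, $k\in\{1,\dots,m\}$, $\beta_h\in\{-1,1\}$.
   Context: Regression type model: there are $m$ machines; machine $k$ observes $(T_i^{(k)},X_i^{(k)})$, $i=1,\dots,n$; all pairs are i.i.d. with $T_i^{(k)}\sim\mathrm{Unif}[0,1]$ and $X_i^{(k)}\mid T_i^{(k)}\sim p_{X\mid T}(\cdot\mid f(T_i^{(k)}))$ (the conditional density depends on the design point only through the value of $f$ there). $N=nm$; asymptotics ($O$, $o$, $\asymp$) are as $n\to\infty$, with $m$ and the budgets possibly depending on $n$; $O$ bounds are uniform in $i,k,h,\boldsymbol\beta$; $r>0$ is fixed. $N_{\text{bass}}$ is, for communication budgets $B^{(1)},\dots,B^{(m)}$, the solution of $N_{\text{bass}}=\max\big(n\log N,\ n\sum_{k=1}^m\big(\frac{B^{(k)}\log N}{N_{\text{bass}}^{1/(1+2r)}}\wedge1\big)\big)$. Sieve: let $\psi_{jh}$ be compactly supported (boundary-corrected) Daubechies wavelets on $[0,1]$ with $S>r$ vanishing moments. For $d=c2^j$ ($0<c<1$ a constant depending on $r$),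 $[0,1]$ is partitioned into disjoint intervals $I_1,\dots,I_d$ of length $1/d$, each $I_h$ containing the full support of one level-$j$ wavelet, re-indexed as $\psi_{jh}$, $h=1,\dots,d$. For $\boldsymbol\beta\in\{-1,1\}^d$ let $f_{\boldsymbol\beta}(t)=\epsilon d^{-(r+1/2)}\sum_{h=1}^d\beta_h\psi_{jh}(t)$; $\mathbb P_{\boldsymbol\beta}$ and expectations refer to data generated with $f=f_{\boldsymbol\beta}+C_0$; $\mathbb P_{\beta_h}$ is used for events depending on the distribution only through $\beta_h$. The log-likelihood ratio of one observation is $W_d^{(k)}(x,t,\boldsymbol\beta,\boldsymbol\beta')=\log\frac{p_{X\mid T}(x\mid f_{\boldsymbol\beta}(t)+C_0)}{p_{X\mid T}(x\mid f_{\boldsymbol\beta'}(t)+C_0)}$; for $t\in I_h$ it depends only on $\beta_h,\beta_h'$. Sub-exponential: $X\sim SE(\nu^2,b)$, with $b\ge0$, means $\mathbb E[e^{\lambda(X-\mathbb E X)}]\le e^{\nu^2\lambda^2/2}$ for all $|\lambda|\le1/b$ (with $1/0=\infty$). *)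

theory Defs
  imports
    "HOL-Probability.Probability"
    "HOL-Library.Landau_Symbols"
    "HOL-Computational_Algebra.Polynomial"
begin

section \<open>Boundary-corrected Daubechies wavelets\<close>

text \<open>
  Orthonormal filters of the minimal length \<open>2 * S\<close> with \<open>S\<close> vanishing moments.  The index range is
  shifted so that the scaling function and the wavelet are both supported in \<open>{1 - S..S}\<close>.  All
  spectral factorisations (minimal phase, least asymmetric, ...) are admitted.
\<close>

definition daubechies_filter :: "nat \<Rightarrow> (int \<Rightarrow> real) \<Rightarrow> bool" where
  "daubechies_filter S u \<longleftrightarrow>
     1 \<le> S \<and>
     (\<forall>k. u k \<noteq> 0 \<longrightarrow> k \<in> {1 - int S..int S}) \<and>
     (\<Sum>k = 1 - int S..int S. u k) = sqrt 2 \<and>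
     (\<forall>l. (\<Sum>k = 1 - int S..int S. u k * u (k + 2 * l)) = (if l = 0 then 1 else 0)) \<and>
     (\<forall>q<S. (\<Sum>k = 1 - int S..int S. (-1) powi k * real_of_int k ^ q * u k) = 0)"

definition daubechies_pair :: "nat \<Rightarrow> (real \<Rightarrow> real) \<Rightarrow> (real \<Rightarrow> real) \<Rightarrow> bool" where
  "daubechies_pair S \<phi> \<psi> \<longleftrightarrow> (\<exists>u. daubechies_filter S u \<and>
     \<phi> \<in> borel_measurable borel \<and> integrable lborel \<phi> \<and> integrable lborel (\<lambda>t. (\<phi> t)\<^sup>2) \<and>
     (\<integral>t. \<phi> t \<partial>lborel) = 1 \<and>
     (\<forall>t. \<phi> t \<noteq> 0 \<longrightarrow> t \<in> {1 - real S..real S}) \<and>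
     (\<forall>t. \<phi> t = sqrt 2 * (\<Sum>k = 1 - int S..int S. u k * \<phi> (2 * t - of_int k))) \<and>
     (\<forall>t. \<psi> t = sqrt 2 * (\<Sum>k = 1 - int S..int S. (-1) powi k * u (1 - k) * \<phi> (2 * t - of_int k))))"

text \<open>
  The level-\<open>j\<close> space of Cohen, Daubechies and Vial on \<open>[0,1]\<close> (functions extended by zero).  The
  coefficients are free for the interior translates \<open>S \<le> k < 2 ^ j - S\<close>; the translates near
  an end point enter only with coefficients that are polynomial in \<open>k\<close> of degree below \<open>S\<close>.
  This leaves \<open>S\<close> dimensions at each end, and exactly what reproduces polynomials of degree
  below \<open>S\<close> on \<open>[0,1]\<close>.
\<close>

definition cdv_space :: "nat \<Rightarrow> (real \<Rightarrow> real) \<Rightarrow> nat \<Rightarrow> (real \<Rightarrow> real) set" where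
  "cdv_space S \<phi> j = {g. \<exists>(a :: int \<Rightarrow> real) (P :: real poly) (Q :: real poly).
     degree P < S \<and> degree Q < S \<and>
     (\<forall>k<int S. a k = poly P (of_int k)) \<and>
     (\<forall>k\<ge>2 ^ j - int S. a k = poly Q (of_int k)) \<and>
     (\<forall>t. g t = indicator {0..1} t *
        (\<Sum>k = 1 - int S..2 ^ j + int S - 2. a k * (2 powr (real j / 2) * \<phi> (2 ^ j * t - of_int k))))}"

definition ip01 :: "(real \<Rightarrow> real) \<Rightarrow> (real \<Rightarrow> real) \<Rightarrow> real" where
  "ip01 f g = (LINT t:{0..1}|lborel. f t * g t)"

text \<open>
  \<open>\<Psi> j k\<close>, \<open>k < 2 ^ j\<close>, is an orthonormal basis of the orthogonal complement of level \<open>j\<close> in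
  level \<open>j + 1\<close>: the interior members are dilated translates of the Daubechies wavelet, the \<open>S\<close>
  members at each end are dilates of fixed compactly supported edge wavelets.  Levels with
  \<open>2 ^ j < 4 * S\<close>, where the two edges may interact, are left unspecified.
\<close>

definition boundary_daubechies_wavelets :: "nat \<Rightarrow> (nat \<Rightarrow> nat \<Rightarrow> real \<Rightarrow> real) \<Rightarrow> bool" where
  "boundary_daubechies_wavelets S \<Psi> \<longleftrightarrow> (\<exists>\<phi> \<psi> (\<psi>l :: nat \<Rightarrow> real \<Rightarrow> real) (\<psi>r :: nat \<Rightarrow> real \<Rightarrow> real).
     daubechies_pair S \<phi> \<psi> \<and>
     (\<forall>k s. \<psi>l k s \<noteq> 0 \<longrightarrow> s \<in> {0..2 * real S - 1}) \<and>
     (\<forall>k s. \<psi>r k s \<noteq> 0 \<longrightarrow> s \<in> {0..2 * real S - 1}) \<and>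
     (\<forall>j. 4 * S \<le> 2 ^ j \<longrightarrow>
        (\<forall>k<2 ^ j. \<Psi> j k \<in> cdv_space S \<phi> (Suc j)) \<and>
        (\<forall>k<2 ^ j. \<forall>g\<in>cdv_space S \<phi> j. ip01 (\<Psi> j k) g = 0) \<and>
        (\<forall>k<2 ^ j. \<forall>l<2 ^ j. ip01 (\<Psi> j k) (\<Psi> j l) = (if k = l then 1 else 0)) \<and>
        (\<forall>k t. S \<le> k \<and> k < 2 ^ j - S \<longrightarrow>
           \<Psi> j k t = 2 powr (real j / 2) * \<psi> (2 ^ j * t - real k)) \<and>
        (\<forall>k<S. \<forall>t\<in>{0..1}. \<Psi> j k t = 2 powr (real j / 2) * \<psi>l k (2 ^ j * t)) \<and>
        (\<forall>k<S. \<forall>t\<in>{0..1}. \<Psi> j (2 ^ j - 1 - k) t = 2 powr (real j / 2) * \<psi>r k (2 ^ j * (1 - t)))))"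


section \<open>The sieve\<close>

text \<open>Cells are half-open so as to partition \<open>[0,1]\<close>; the last one also contains \<open>1\<close>.\<close>

definition cell :: "nat \<Rightarrow> nat \<Rightarrow> real set" where
  "cell d h = {real h / real d..<real (Suc h) / real d} \<union> (if Suc h = d then {1} else {})"

definition sign_vectors :: "nat \<Rightarrow> (nat \<Rightarrow> real) set" where
  "sign_vectors d = {..<d} \<rightarrow>\<^sub>E {-1, 1}"

definition opposite :: "nat \<Rightarrow> (nat \<Rightarrow> real) \<Rightarrow> nat \<Rightarrow> real" where
  "opposite d \<beta> = (\<lambda>h\<in>{..<d}. - \<beta> h)"

definition sieve :: "real \<Rightarrow> real \<Rightarrow> nat \<Rightarrow> (nat \<Rightarrow> real \<Rightarrow> real) \<Rightarrow> (nat \<Rightarrow> real) \<Rightarrow> real \<Rightarrow> real" where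
  "sieve r \<epsilon> d \<psi> \<beta> t = \<epsilon> * real d powr (- (r + 1 / 2)) * (\<Sum>h<d. \<beta> h * \<psi> h t)"


section \<open>Regression type models\<close>

text \<open>
  \<open>p x \<theta>\<close> is the density, with respect to the dominating measure \<open>\<mu>\<close>, of a response when the
  regression function takes the value \<open>\<theta>\<close> at the design point.
\<close>

definition density_family :: "'x measure \<Rightarrow> ('x \<Rightarrow> real \<Rightarrow> real) \<Rightarrow> bool" where
  "density_family \<mu> p \<longleftrightarrow>
     sigma_finite_measure \<mu> \<and>
     case_prod p \<in> borel_measurable (\<mu> \<Otimes>\<^sub>M borel) \<and>
     (\<forall>x \<theta>. 0 \<le> p x \<theta>) \<and>
     (\<forall>\<theta>. (\<integral>\<^sup>+x. ennreal (p x \<theta>) \<partial>\<mu>) = 1)"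

definition response_law :: "'x measure \<Rightarrow> ('x \<Rightarrow> real \<Rightarrow> real) \<Rightarrow> real \<Rightarrow> 'x measure" where
  "response_law \<mu> p \<theta> = density \<mu> (\<lambda>x. ennreal (p x \<theta>))"

definition design_law :: "real measure" where
  "design_law = uniform_measure lborel {0..1}"

text \<open>Law of one observation \<open>(T, X)\<close>; \<open>response_law \<mu> p (f t)\<close> is the law of \<open>X\<close> given \<open>T = t\<close>.\<close>

definition obs_law ::
  "'x measure \<Rightarrow> ('x \<Rightarrow> real \<Rightarrow> real) \<Rightarrow> (real \<Rightarrow> real) \<Rightarrow> (real \<times> 'x) measure" where
  "obs_law \<mu> p f = density (design_law \<Otimes>\<^sub>M \<mu>) (\<lambda>(t, x). ennreal (p x (f t)))"

text \<open>The pair at index \<open>(k, i)\<close> is observation \<open>i\<close> of machine \<open>k\<close>.\<close>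

definition data_law ::
  "nat \<Rightarrow> nat \<Rightarrow> 'x measure \<Rightarrow> ('x \<Rightarrow> real \<Rightarrow> real) \<Rightarrow> (real \<Rightarrow> real) \<Rightarrow> (nat \<times> nat \<Rightarrow> real \<times> 'x) measure"
where
  "data_law n m \<mu> p f = (\<Pi>\<^sub>M _\<in>{..<m} \<times> {..<n}. obs_law \<mu> p f)"

definition log_lik_ratio ::
  "('x \<Rightarrow> real \<Rightarrow> real) \<Rightarrow> (real \<Rightarrow> real) \<Rightarrow> (real \<Rightarrow> real) \<Rightarrow> 'x \<Rightarrow> real \<Rightarrow> real" where
  "log_lik_ratio p f f' x t = ln (p x (f t) / p x (f' t))"

definition cond_mean_llr ::
  "'x measure \<Rightarrow> ('x \<Rightarrow> real \<Rightarrow> real) \<Rightarrow> (real \<Rightarrow> real) \<Rightarrow> (real \<Rightarrow> real) \<Rightarrow> real \<Rightarrow> real" where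
  "cond_mean_llr \<mu> p f f' t = (\<integral>x. log_lik_ratio p f f' x t \<partial>response_law \<mu> p (f t))"

text \<open>
  \<open>v\<close> is the variance proxy.  The condition \<open>b * \<bar>l\<bar> \<le> 1\<close> is \<open>\<bar>l\<bar> \<le> 1 / b\<close> with the
  convention that \<open>1 / 0\<close> is infinite.
\<close>

definition sub_exponential :: "'x measure \<Rightarrow> ('x \<Rightarrow> real) \<Rightarrow> real \<Rightarrow> real \<Rightarrow> bool" where
  "sub_exponential M X v b \<longleftrightarrow>
     0 \<le> b \<and> integrable M X \<and>
     (\<forall>l. b * \<bar>l\<bar> \<le> 1 \<longrightarrow>
        integrable M (\<lambda>x. exp (l * (X x - (\<integral>y. X y \<partial>M)))) \<and>
        (\<integral>x. exp (l * (X x - (\<integral>y. X y \<partial>M))) \<partial>M) \<le> exp (v * l\<^sup>2 / 2))"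

definition solves_N_bass :: "real \<Rightarrow> nat \<Rightarrow> nat \<Rightarrow> (nat \<Rightarrow> real) \<Rightarrow> real \<Rightarrow> bool" where
  "solves_N_bass r n m B x \<longleftrightarrow>
     x = max (real n * ln (real (n * m)))
             (real n * (\<Sum>k<m. min (B k * ln (real (n * m)) / x powr (1 / (1 + 2 * r))) 1))"

text \<open>
  \<open>F \<beta>\<close> is the regression function attached to the sign vector \<open>\<beta>\<close>, \<open>D\<close> the law of the data.
\<close>

definition good_event ::
  "(nat \<times> nat \<Rightarrow> real \<times> 'x) measure \<Rightarrow> ('x \<Rightarrow> real \<Rightarrow> real) \<Rightarrow> ((nat \<Rightarrow> real) \<Rightarrow> real \<Rightarrow> real) \<Rightarrow>
    nat \<Rightarrow> nat \<Rightarrow> nat \<Rightarrow> nat \<Rightarrow> real \<Rightarrow> (nat \<times> nat \<Rightarrow> real \<times> 'x) set" where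
  "good_event D p F n d h k a = {\<omega> \<in> space D.
     (MAX (\<beta>, \<beta>')\<in>sign_vectors d \<times> sign_vectors d.
        \<Sum>i | i < n \<and> fst (\<omega> (k, i)) \<in> cell d h.
          log_lik_ratio p (F \<beta>) (F \<beta>') (snd (\<omega> (k, i))) (fst (\<omega> (k, i)))) \<le> a}"

end

theory Submission
  imports Defs "HOL-Real_Asymp.Real_Asymp"
begin

text \<open>
  Write \<open>N = n m\<close>.  The wavelets have their supports in disjoint cells, so on the cell \<open>h\<close> only the
  \<open>h\<close>-th sign matters.  The maximum over pairs of sign vectors is therefore \<open>\<bar>T\<bar>\<close>, where \<open>T\<close> is the sum
  of the log-likelihood ratios \<open>W\<close> of the true vector against its opposite over
  the design points in the cell (\<open>good_event_eq_abs_le\<close>).  It remains to bound the two tails of \<open>T\<close>,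
  a sum of \<open>n\<close> independent terms \<open>1\<^sub>I W\<close>.

  Everything hinges on the conditional mean of \<open>W\<close> given the design point being \<open>O(d\<^bsup>- 2 r\<^esup>)\<close>
  pointwise: a mean of order \<open>d\<^sup>-\<^sup>r\<close> throughout the cell would produce a drift of \<open>T\<close> beyond the
  threshold.  The pointwise bound comes from the fact that \<open>W\<close> is a log-likelihood ratio:
  \<open>E e\<^sup>-\<^sup>W = 1\<close>, and comparing this with the sub-exponential bound at \<open>-1\<close> yields
  \<open>0 \<le> E W \<le> \<nu>\<^sup>2 g\<^sub>1\<^sup>2 / 2\<close>.  With \<open>K\<close> enlarged to be at least \<open>1\<close>, it follows that
  \<open>E e\<^bsup>l W\<^esup> \<le> e\<^bsup>l\<^sup>2 K d\<^bsup>- 2 r\<^esup>\<^esup>\<close> for \<open>\<bar>l\<bar> \<ge> 1\<close> in the sub-exponential range (\<open>log_ratio_mgf\<close>),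
  and averaging over the design point gains the factor \<open>1 / d\<close> (\<open>cell_llr_mgf\<close>).

  Chernoff's bound with \<open>l = d\<^bsup>1 / 2 + r\<^esup> sqrt (ln N / n)\<close> and the threshold
  \<open>C \<epsilon> d\<^bsup>- 1 / 2 - r\<^esup> sqrt (n ln N)\<close> makes the exponent \<open>(2 K - C \<epsilon>) ln N\<close>, so a suitable \<open>C\<close> gives the
  tail \<open>N\<^sup>-\<^sup>3\<close>, which is \<open>o(m\<^sup>-\<^sup>2 d\<^sup>-\<^sup>2)\<close> because \<open>d \<le> n\<close>.  This \<open>l\<close> is admissible for two
  reasons (\<open>dimension_asymptotics\<close>): \<open>l \<ge> 1\<close> because \<open>d\<^bsup>1 + 2 r\<^esup>\<close> is at least of order \<open>n ln N\<close>,
  and \<open>l\<close> stays in the sub-exponential range because \<open>d ln N / n\<close> tends to \<open>0\<close>, which is where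
  \<open>\<gamma> < 2 r\<close> enters.
\<close>

section \<open>Cells, sign vectors and the sieve\<close>

lemma cell_unique:
  assumes "h < d" "h' < d" "t \<in> cell d h" "t \<in> cell d h'"
  shows "h = h'"
proof -
  have floor: "nat \<lfloor>t * real d\<rfloor> = i" if "i < d" "t \<in> cell d i" "t < 1" for i
  proof -
    have "real i \<le> t * real d" "t * real d < real i + 1"
      using that by (auto simp: cell_def field_simps split: if_splits)
    then show ?thesis by linarith
  qed
  \<comment> \<open>A half-open piece of a cell with index below \<open>d\<close> lies to the left of \<open>1\<close>,
    so the point \<open>1\<close> can only come from the cell that contains it by definition.\<close>
  have last: "Suc i = d" if "i < d" "t \<in> cell d i" "\<not> t < 1" for i
  proof (rule ccontr)
    assume "Suc i \<noteq> d"
    with that(2) have "t < real (Suc i) / real d" by (auto simp: cell_def)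
    also have "\<dots> \<le> 1" using that(1) by (auto simp: field_simps)
    finally show False using that(3) by simp
  qed
  show ?thesis
    using assms floor[of h] floor[of h'] last[of h] last[of h'] by (cases "t < 1") auto
qed

lemma cell_borel [measurable]: "cell d h \<in> sets borel"
  by (simp add: cell_def)

lemma sieve_on_cell:
  assumes supp: "\<And>i. i < d \<Longrightarrow> {t. \<psi> i t \<noteq> 0} \<subseteq> cell d i" and h: "h < d" and t: "t \<in> cell d h"
  shows "sieve r \<epsilon> d \<psi> \<beta> t = \<epsilon> * real d powr (- (r + 1 / 2)) * (\<beta> h * \<psi> h t)"
proof -
  have "\<psi> i t = 0" if "i < d" "i \<noteq> h" for i
    using supp[OF that(1)] cell_unique[OF that(1) h _ t] that(2) by auto
  then have "(\<Sum>i<d. \<beta> i * \<psi> i t) = (\<Sum>i\<in>{h}. \<beta> i * \<psi> i t)"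
    using h by (intro sum.mono_neutral_right) auto
  then show ?thesis by (simp add: sieve_def)
qed

lemma finite_sign_vectors: "finite (sign_vectors d)"
  unfolding sign_vectors_def by (intro finite_PiE) auto

lemma opposite_sign_vectors: "\<beta> \<in> sign_vectors d \<Longrightarrow> opposite d \<beta> \<in> sign_vectors d"
  by (fastforce simp: sign_vectors_def opposite_def PiE_iff)

lemma opposite_opposite: "\<beta> \<in> sign_vectors d \<Longrightarrow> opposite d (opposite d \<beta>) = \<beta>"
  by (auto simp: sign_vectors_def opposite_def PiE_iff extensional_def restrict_def fun_eq_iff)

lemma log_lik_ratio_cong:
  "f t = g t \<Longrightarrow> f' t = g' t \<Longrightarrow> log_lik_ratio p f f' x t = log_lik_ratio p g g' x t"
  by (simp add: log_lik_ratio_def)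

text \<open>
  Where the density vanishes, the quotient \<open>0 / 0 = 0\<close> and \<open>ln 0 = 0\<close> keep the identity true; the
  same default makes the antisymmetry below hold at every point and not just almost surely.
\<close>

lemma log_lik_ratio_self: "f t = f' t \<Longrightarrow> log_lik_ratio p f f' x t = 0"
  by (cases "p x (f' t) = 0") (auto simp: log_lik_ratio_def)

lemma log_lik_ratio_swap: "log_lik_ratio p f' f x t = - log_lik_ratio p f f' x t"
proof -
  have "p x (f' t) / p x (f t) = inverse (p x (f t) / p x (f' t))" by simp
  then show ?thesis unfolding log_lik_ratio_def by (metis ln_inverse)
qed

text \<open>
  A member of a multiresolution space is a finite combination of dilated translates of the scaling
  function.  Measurability of the sieve rests on this: the good event has to be measurable,
  since the measure of a non-measurable set is \<open>0\<close> by convention.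
\<close>

lemma boundary_wavelet_measurable:
  assumes "boundary_daubechies_wavelets S \<Psi>" "4 * S \<le> 2 ^ j" "k < 2 ^ j"
  shows "\<Psi> j k \<in> borel_measurable borel"
proof -
  obtain \<phi> \<psi> where \<phi>: "daubechies_pair S \<phi> \<psi>"
    and levels: "\<forall>j. 4 * S \<le> 2 ^ j \<longrightarrow> (\<forall>k<2 ^ j. \<Psi> j k \<in> cdv_space S \<phi> (Suc j))"
    using assms(1)[unfolded boundary_daubechies_wavelets_def]
  proof (elim exE conjE, goal_cases)
    case (1 \<phi> \<psi> \<psi>l \<psi>r)
    from 1(5) have "\<forall>j. 4 * S \<le> 2 ^ j \<longrightarrow> (\<forall>k<2 ^ j. \<Psi> j k \<in> cdv_space S \<phi> (Suc j))"
      by (rule all_forward) (erule imp_forward, assumption, erule conjunct1)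
    with 1(2) show ?case by (rule 1(1))
  qed
  from levels assms(2,3) have \<Psi>: "\<Psi> j k \<in> cdv_space S \<phi> (Suc j)" by blast
  have [measurable]: "\<phi> \<in> borel_measurable borel"
    using \<phi> unfolding daubechies_pair_def by blast
  obtain a where a: "\<And>t. \<Psi> j k t = indicator {0..1} t * (\<Sum>i = 1 - int S..2 ^ Suc j + int S - 2.
      a i * (2 powr (real (Suc j) / 2) * \<phi> (2 ^ Suc j * t - of_int i)))"
    using \<Psi> unfolding cdv_space_def by blast
  have "\<Psi> j k = (\<lambda>t. indicator {0..1} t * (\<Sum>i = 1 - int S..2 ^ Suc j + int S - 2.
      a i * (2 powr (real (Suc j) / 2) * \<phi> (2 ^ Suc j * t - of_int i))))"
    using a by auto
  then show ?thesis by simp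
qed

lemma sieve_measurable:
  assumes [measurable]: "\<And>h. h < d \<Longrightarrow> \<psi> h \<in> borel_measurable borel"
  shows "sieve r \<epsilon> d \<psi> \<beta> \<in> borel_measurable borel"
proof -
  have "(\<lambda>t. \<epsilon> * real d powr (- (r + 1 / 2)) * (\<Sum>h<d. \<beta> h * \<psi> h t)) \<in> borel_measurable borel"
    by (intro borel_measurable_times borel_measurable_sum borel_measurable_const) auto
  then show ?thesis by (simp add: sieve_def[abs_def])
qed

section \<open>The laws of the regression type model\<close>

lemma prob_space_design_law: "prob_space design_law"
  unfolding design_law_def by (rule prob_space_uniform_measure) auto

lemma sets_design_law [simp, measurable_cong]: "sets design_law = sets borel"
  by (simp add: design_law_def)

lemma AE_design_law: "AE t in design_law. t \<in> {0..1}"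
  unfolding design_law_def by (rule AE_uniform_measureI) auto

lemma emeasure_cell:
  assumes "h < d"
  shows "emeasure design_law (cell d h) \<le> ennreal (1 / real d)"
proof -
  have "emeasure design_law (cell d h) = emeasure lborel ({0..1} \<inter> cell d h)"
    by (simp add: design_law_def divide_ennreal_def)
  also have "\<dots> \<le> emeasure lborel ({real h / real d..<real (Suc h) / real d} \<union> {1})"
    by (intro emeasure_mono) (auto simp: cell_def split: if_splits)
  also have "\<dots> \<le> emeasure lborel {real h / real d..<real (Suc h) / real d} + emeasure lborel {1::real}"
    by (intro emeasure_subadditive) auto
  also have "\<dots> = ennreal (real (Suc h) / real d - real h / real d)"
    by (simp add: divide_right_mono)
  also have "real (Suc h) / real d - real h / real d = 1 / real d"
    by (simp add: diff_divide_distrib[symmetric])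
  finally show ?thesis .
qed

lemma density_measurable:
  assumes "density_family \<mu> p"
  shows "(\<lambda>x. p x \<theta>) \<in> borel_measurable \<mu>"
proof -
  have [measurable]: "case_prod p \<in> borel_measurable (\<mu> \<Otimes>\<^sub>M borel)"
    using assms by (simp add: density_family_def)
  have "(\<lambda>x. case_prod p (x, \<theta>)) \<in> borel_measurable \<mu>" by measurable
  then show ?thesis by simp
qed

lemma regression_density_measurable:
  assumes "density_family \<mu> p" "f \<in> borel_measurable borel"
  shows "(\<lambda>(t, x). p x (f t)) \<in> borel_measurable (borel \<Otimes>\<^sub>M \<mu>)"
proof -
  have [measurable]: "case_prod p \<in> borel_measurable (\<mu> \<Otimes>\<^sub>M borel)" "f \<in> borel_measurable borel"
    using assms by (auto simp: density_family_def)
  have "(\<lambda>z. case_prod p (snd z, f (fst z))) \<in> borel_measurable (borel \<Otimes>\<^sub>M \<mu>)" by measurable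
  then show ?thesis by (simp add: case_prod_beta')
qed

lemma log_lik_ratio_measurable:
  assumes model: "density_family \<mu> p" and f: "f \<in> borel_measurable borel" "f' \<in> borel_measurable borel"
  shows "(\<lambda>z. log_lik_ratio p f f' (snd z) (fst z)) \<in> borel_measurable (borel \<Otimes>\<^sub>M \<mu>)"
proof -
  note [measurable] = regression_density_measurable[OF model f(1)] regression_density_measurable[OF model f(2)]
  have "(\<lambda>z. ln ((case z of (t, x) \<Rightarrow> p x (f t)) / (case z of (t, x) \<Rightarrow> p x (f' t))))
    \<in> borel_measurable (borel \<Otimes>\<^sub>M \<mu>)" by measurable
  then show ?thesis by (simp add: log_lik_ratio_def case_prod_beta')
qed

lemma sets_obs_law [simp, measurable_cong]: "sets (obs_law \<mu> p f) = sets (borel \<Otimes>\<^sub>M \<mu>)"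
  unfolding obs_law_def by (simp cong: sets_pair_measure_cong)

lemma sets_response_law [simp, measurable_cong]: "sets (response_law \<mu> p \<theta>) = sets \<mu>"
  unfolding response_law_def by simp

text \<open>
  Conditioning on the design point.  The inner integral is later bounded by constants, uniformly
  over a cell, so that conditional information on the response is only needed pointwise in \<open>t\<close>.
\<close>

lemma nn_integral_obs_law:
  assumes model: "density_family \<mu> p" and f: "f \<in> borel_measurable borel"
    and [measurable]: "G \<in> borel_measurable (borel \<Otimes>\<^sub>M \<mu>)"
  shows "(\<integral>\<^sup>+z. G z \<partial>obs_law \<mu> p f)
    = (\<integral>\<^sup>+t. (\<integral>\<^sup>+x. G (t, x) \<partial>response_law \<mu> p (f t)) \<partial>design_law)"
proof -
  interpret sigma_finite_measure \<mu> using model by (simp add: density_family_def)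
  note [measurable] = regression_density_measurable[OF model f]
  have "(\<integral>\<^sup>+z. G z \<partial>obs_law \<mu> p f)
      = (\<integral>\<^sup>+z. (case z of (t, x) \<Rightarrow> ennreal (p x (f t))) * G z \<partial>(design_law \<Otimes>\<^sub>M \<mu>))"
    unfolding obs_law_def by (subst nn_integral_density) auto
  also have "\<dots> = (\<integral>\<^sup>+t. \<integral>\<^sup>+x. ennreal (p x (f t)) * G (t, x) \<partial>\<mu> \<partial>design_law)"
    by (subst nn_integral_fst[symmetric]) auto
  also have "\<dots> = (\<integral>\<^sup>+t. (\<integral>\<^sup>+x. G (t, x) \<partial>response_law \<mu> p (f t)) \<partial>design_law)"
    unfolding response_law_def by (intro nn_integral_cong, subst nn_integral_density) auto
  finally show ?thesis .
qed

lemma prob_space_response_law: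
  assumes model: "density_family \<mu> p"
  shows "prob_space (response_law \<mu> p \<theta>)"
proof
  note [measurable] = density_measurable[OF model]
  show "emeasure (response_law \<mu> p \<theta>) (space (response_law \<mu> p \<theta>)) = 1"
    using model by (simp add: response_law_def emeasure_density density_family_def cong: nn_integral_cong)
qed

lemma prob_space_obs_law:
  assumes model: "density_family \<mu> p" and f: "f \<in> borel_measurable borel"
  shows "prob_space (obs_law \<mu> p f)"
proof
  interpret D: prob_space design_law by (rule prob_space_design_law)
  interpret R: prob_space "response_law \<mu> p \<theta>" for \<theta> by (rule prob_space_response_law[OF model])
  have "emeasure (obs_law \<mu> p f) (space (obs_law \<mu> p f)) = (\<integral>\<^sup>+z. 1 \<partial>obs_law \<mu> p f)"
    by simp
  also have "\<dots> = 1"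
    by (subst nn_integral_obs_law[OF model f]) (auto simp: R.emeasure_space_1 D.emeasure_space_1)
  finally show "emeasure (obs_law \<mu> p f) (space (obs_law \<mu> p f)) = 1" .
qed

lemma data_law_sum_measurable:
  fixes Y :: "real \<times> 'x \<Rightarrow> real"
  assumes Y: "Y \<in> borel_measurable (borel \<Otimes>\<^sub>M \<mu>)" and k: "k < m"
  shows "(\<lambda>\<omega>. \<Sum>i<n. Y (\<omega> (k, i))) \<in> borel_measurable (data_law n m \<mu> p f)"
proof -
  have [measurable]: "(\<lambda>\<omega>. \<omega> (k, i)) \<in> measurable (data_law n m \<mu> p f) (borel \<Otimes>\<^sub>M \<mu>)" if "i < n" for i
  proof -
    have "(\<lambda>\<omega>. \<omega> (k, i)) \<in> measurable (data_law n m \<mu> p f) (obs_law \<mu> p f)"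
      unfolding data_law_def using that k by (intro measurable_component_singleton) auto
    then show ?thesis by (simp cong: measurable_cong_sets)
  qed
  show ?thesis
    by (intro borel_measurable_sum) (auto intro: measurable_compose[OF _ Y])
qed

text \<open>
  The exponential moment of the sum factorises over the independent observations.  It is written as
  a product over all index pairs, with the factor \<open>1\<close> for the observations of the other machines.
\<close>

lemma chernoff_data_law:
  assumes model: "density_family \<mu> p" and f: "f \<in> borel_measurable borel"
    and Y[measurable]: "Y \<in> borel_measurable (borel \<Otimes>\<^sub>M \<mu>)"
    and mgf: "(\<integral>\<^sup>+z. ennreal (exp (l * Y z)) \<partial>obs_law \<mu> p f) \<le> ennreal (exp s)"
    and l: "0 < l" and k: "k < m"
  shows "measure (data_law n m \<mu> p f) {\<omega> \<in> space (data_law n m \<mu> p f). a < (\<Sum>i<n. Y (\<omega> (k, i)))}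
    \<le> exp (real n * s - l * a)"
proof -
  let ?D = "data_law n m \<mu> p f" and ?O = "obs_law \<mu> p f"
  let ?J = "{..<m} \<times> {..<n}"
  interpret O: prob_space ?O by (rule prob_space_obs_law[OF model f])
  interpret product_sigma_finite "\<lambda>_ :: nat \<times> nat. ?O" ..
  interpret product_prob_space "\<lambda>_ :: nat \<times> nat. ?O" ?J ..
  let ?G = "\<lambda>q :: nat \<times> nat. \<lambda>z. if fst q = k then ennreal (exp (l * Y z)) else 1"
  have "Y \<in> borel_measurable ?O"
    using Y by (simp cong: measurable_cong_sets)
  then have [measurable]: "?G q \<in> borel_measurable ?O" for q
    by (cases "fst q = k") simp_all
  have S[measurable]: "(\<lambda>\<omega>. \<Sum>i<n. Y (\<omega> (k, i))) \<in> borel_measurable ?D"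
    by (rule data_law_sum_measurable[OF Y k])
  have row: "{q \<in> ?J. fst q = k} = (\<lambda>i. (k, i)) ` {..<n}" using k by auto
  have "(\<Prod>q\<in>?J. ?G q (\<omega> q)) = ennreal (exp (l * (\<Sum>i<n. Y (\<omega> (k, i)))))" for \<omega>
  proof -
    have "(\<Prod>q\<in>?J. ?G q (\<omega> q)) = (\<Prod>q\<in>{q \<in> ?J. fst q = k}. ennreal (exp (l * Y (\<omega> q))))"
      by (subst prod.inter_filter) auto
    also have "\<dots> = (\<Prod>i<n. ennreal (exp (l * Y (\<omega> (k, i)))))"
      unfolding row by (subst prod.reindex) (auto simp: inj_on_def)
    also have "\<dots> = ennreal (\<Prod>i<n. exp (l * Y (\<omega> (k, i))))"
      by (rule prod_ennreal) auto
    finally show ?thesis by (simp add: exp_sum sum_distrib_left)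
  qed
  then have "(\<integral>\<^sup>+\<omega>. ennreal (exp (l * (\<Sum>i<n. Y (\<omega> (k, i))))) \<partial>?D) = (\<integral>\<^sup>+\<omega>. (\<Prod>q\<in>?J. ?G q (\<omega> q)) \<partial>?D)"
    by simp
  also have "\<dots> = (\<Prod>q\<in>?J. \<integral>\<^sup>+z. ?G q z \<partial>?O)"
    unfolding data_law_def by (rule product_nn_integral_prod) auto
  also have "\<dots> = (\<Prod>q\<in>?J. if fst q = k then (\<integral>\<^sup>+z. ennreal (exp (l * Y z)) \<partial>?O) else 1)"
    by (intro prod.cong refl) (auto simp: O.emeasure_space_1)
  also have "\<dots> = (\<Prod>i<n. (\<integral>\<^sup>+z. ennreal (exp (l * Y z)) \<partial>?O))"
    by (subst prod.inter_filter[symmetric], simp, subst row, subst prod.reindex) (auto simp: inj_on_def)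
  also have "\<dots> \<le> (\<Prod>i<n. ennreal (exp s))"
    by (intro prod_mono_ennreal mgf)
  also have "\<dots> = ennreal (exp (real n * s))"
    by (simp add: ennreal_power exp_of_nat_mult)
  finally have prod: "(\<integral>\<^sup>+\<omega>. ennreal (exp (l * (\<Sum>i<n. Y (\<omega> (k, i))))) \<partial>?D) \<le> ennreal (exp (real n * s))" .
  have "emeasure ?D {\<omega> \<in> space ?D. a < (\<Sum>i<n. Y (\<omega> (k, i)))}
      \<le> emeasure ?D {\<omega> \<in> space ?D. a \<le> (\<Sum>i<n. Y (\<omega> (k, i)))}"
    by (intro emeasure_mono) auto
  also have "\<dots> \<le> ennreal (exp (- l * a))
      * (\<integral>\<^sup>+\<omega>\<in>space ?D. ennreal (exp (l * (\<Sum>i<n. Y (\<omega> (k, i))))) \<partial>?D)"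
    by (rule Chernoff_ineq_nn_integral_ge[OF l]) auto
  also have "\<dots> \<le> ennreal (exp (- l * a)) * ennreal (exp (real n * s))"
    using prod by (intro mult_left_mono) (auto cong: nn_integral_cong)
  also have "\<dots> = ennreal (exp (real n * s - l * a))"
    by (simp add: ennreal_mult'[symmetric] exp_add[symmetric])
  finally show ?thesis
    unfolding measure_def by (rule enn2real_leI[rotated]) simp
qed

section \<open>Exponential moments of the log-likelihood ratio\<close>

text \<open>
  Integrating the inverse likelihood ratio turns the density at \<open>\<theta>\<close> into the one at \<open>\<theta>'\<close>.  Mutual
  absolute continuity is what makes the total mass exactly \<open>1\<close>.
\<close>

lemma response_law_likelihood_ratio:
  assumes model: "density_family \<mu> p"
    and ac: "AE x in response_law \<mu> p \<theta>. 0 < p x \<theta>'" "AE x in response_law \<mu> p \<theta>'. 0 < p x \<theta>"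
  shows "(\<integral>\<^sup>+x. ennreal (exp (- ln (p x \<theta> / p x \<theta>'))) \<partial>response_law \<mu> p \<theta>) = 1"
proof -
  note [measurable] = density_measurable[OF model]
  have nonneg: "0 \<le> p x \<theta>" for x \<theta> using model by (simp add: density_family_def)
  have ac': "AE x in \<mu>. 0 < p x \<theta> \<longrightarrow> 0 < p x \<theta>'" "AE x in \<mu>. 0 < p x \<theta>' \<longrightarrow> 0 < p x \<theta>"
    using ac unfolding response_law_def by (simp_all add: AE_density)
  have "(\<integral>\<^sup>+x. ennreal (exp (- ln (p x \<theta> / p x \<theta>'))) \<partial>response_law \<mu> p \<theta>)
      = (\<integral>\<^sup>+x. ennreal (p x \<theta>) * ennreal (exp (- ln (p x \<theta> / p x \<theta>'))) \<partial>\<mu>)"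
    unfolding response_law_def by (subst nn_integral_density) auto
  also have "\<dots> = (\<integral>\<^sup>+x. ennreal (p x \<theta>') \<partial>\<mu>)"
  proof (intro nn_integral_cong_AE, use ac' in eventually_elim)
    fix x assume *: "0 < p x \<theta> \<longrightarrow> 0 < p x \<theta>'" "0 < p x \<theta>' \<longrightarrow> 0 < p x \<theta>"
    show "ennreal (p x \<theta>) * ennreal (exp (- ln (p x \<theta> / p x \<theta>'))) = ennreal (p x \<theta>')"
    proof (cases "0 < p x \<theta>")
      case True
      with * have "p x \<theta> * exp (- ln (p x \<theta> / p x \<theta>')) = p x \<theta>'"
        by (simp add: exp_minus)
      then show ?thesis using nonneg by (simp add: ennreal_mult'[symmetric])
    next
      case False
      then show ?thesis using * nonneg[of x \<theta>] nonneg[of x \<theta>'] by auto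
    qed
  qed
  also have "\<dots> = 1" using model by (simp add: density_family_def)
  finally show ?thesis .
qed

lemma sub_exponential_affine_mgf:
  assumes "prob_space M" and X: "sub_exponential M X v b"
    and W: "AE x in M. W x = g * X x - e" "W \<in> borel_measurable M"
    and l: "\<bar>l\<bar> * (\<bar>g\<bar> * b) \<le> 1"
  shows "integrable M W" "integrable M (\<lambda>x. exp (l * W x))"
    "(\<integral>x. exp (l * W x) \<partial>M) \<le> exp (l * (\<integral>x. W x \<partial>M) + l\<^sup>2 * (v * g\<^sup>2) / 2)"
proof -
  interpret prob_space M by fact
  define a where "a = (\<integral>x. X x \<partial>M)"
  have [simp]: "integrable M X" using X by (simp add: sub_exponential_def)
  then have [measurable]: "X \<in> borel_measurable M" by (rule borel_measurable_integrable)
  note [measurable] = W(2)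
  have "b * \<bar>l * g\<bar> \<le> 1" using l by (simp add: abs_mult mult_ac)
  then have mgf: "integrable M (\<lambda>x. exp (l * g * (X x - a)))"
    "(\<integral>x. exp (l * g * (X x - a)) \<partial>M) \<le> exp (v * (l * g)\<^sup>2 / 2)"
    using X unfolding sub_exponential_def a_def by blast+
  show "integrable M W"
    using W by (subst integrable_cong_AE[where g = "\<lambda>x. g * X x - e"]) auto
  have EW: "(\<integral>x. W x \<partial>M) = g * a - e"
    using W by (subst integral_cong_AE[where g = "\<lambda>x. g * X x - e"]) (auto simp: a_def prob_space)
  have eq: "AE x in M. exp (l * W x) = exp (l * (g * a - e)) * exp (l * g * (X x - a))"
    using W(1)
  proof eventually_elim
    case (elim x)
    have "l * W x = l * (g * a - e) + l * g * (X x - a)" unfolding elim by (simp add: algebra_simps)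
    then show ?case by (simp add: exp_add)
  qed
  show "integrable M (\<lambda>x. exp (l * W x))"
    using eq mgf by (subst integrable_cong_AE[where g = "\<lambda>x. exp (l * (g * a - e)) * exp (l * g * (X x - a))"]) auto
  have "(\<integral>x. exp (l * W x) \<partial>M) = exp (l * (g * a - e)) * (\<integral>x. exp (l * g * (X x - a)) \<partial>M)"
    using eq by (subst integral_cong_AE[where g = "\<lambda>x. exp (l * (g * a - e)) * exp (l * g * (X x - a))"]) auto
  also have "\<dots> \<le> exp (l * (g * a - e)) * exp (v * (l * g)\<^sup>2 / 2)"
    by (intro mult_left_mono mgf) auto
  also have "\<dots> = exp (l * (\<integral>x. W x \<partial>M) + l\<^sup>2 * (v * g\<^sup>2) / 2)"
    by (simp add: EW exp_add[symmetric] power_mult_distrib mult_ac)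
  finally show "(\<integral>x. exp (l * W x) \<partial>M) \<le> exp (l * (\<integral>x. W x \<partial>M) + l\<^sup>2 * (v * g\<^sup>2) / 2)" .
qed

text \<open>
  The mean \<open>\<kappa>\<close> of the log-likelihood ratio \<open>W\<close> is a Kullback-Leibler divergence, and it is
  controlled by the variance proxy.  Since \<open>E e\<^sup>-\<^sup>W = 1\<close>, the inequality
  \<open>1 - W \<le> e\<^sup>-\<^sup>W\<close> gives \<open>\<kappa> \<ge> 0\<close>, and the sub-exponential bound at the argument \<open>-1\<close> gives
  \<open>e\<^sup>\<kappa> \<le> e\<^bsup>v g\<^sup>2 / 2\<^esup>\<close>.  Hence \<open>l \<kappa>\<close> is at most \<open>\<bar>l\<bar> w / 2\<close>, and for \<open>\<bar>l\<bar> \<ge> 1\<close> this is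
  dominated by the quadratic term.
\<close>

lemma log_ratio_mgf:
  fixes p :: "'x \<Rightarrow> real \<Rightarrow> real" and \<theta> \<theta>' :: real
  defines "W \<equiv> \<lambda>x. ln (p x \<theta> / p x \<theta>')"
  assumes model: "density_family \<mu> p"
    and ac: "AE x in response_law \<mu> p \<theta>. 0 < p x \<theta>'" "AE x in response_law \<mu> p \<theta>'. 0 < p x \<theta>"
    and X: "sub_exponential (response_law \<mu> p \<theta>) X v b"
    and W: "AE x in response_law \<mu> p \<theta>. W x = g * X x - e"
    and w: "v * g\<^sup>2 \<le> w"
    and l: "1 \<le> \<bar>l\<bar>" "\<bar>l\<bar> * (\<bar>g\<bar> * b) \<le> 1"
  shows "(\<integral>\<^sup>+x. ennreal (exp (l * W x)) \<partial>response_law \<mu> p \<theta>) \<le> ennreal (exp (l\<^sup>2 * w))"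
proof -
  let ?M = "response_law \<mu> p \<theta>"
  interpret prob_space ?M by (rule prob_space_response_law[OF model])
  note [measurable] = density_measurable[OF model]
  have meas: "W \<in> borel_measurable ?M" unfolding W_def by measurable
  define \<kappa> where "\<kappa> = (\<integral>x. W x \<partial>?M)"
  have "0 \<le> b" using X by (simp add: sub_exponential_def)
  then have l1: "\<bar>-1\<bar> * (\<bar>g\<bar> * b) \<le> 1"
    using l mult_right_mono[OF l(1), of "\<bar>g\<bar> * b"] by simp
  note lr = sub_exponential_affine_mgf[OF prob_space_axioms X W meas l1]
  note mgf = sub_exponential_affine_mgf[OF prob_space_axioms X W meas l(2)]
  have one: "(\<integral>x. exp (- W x) \<partial>?M) = 1"
    using response_law_likelihood_ratio[OF model ac] meas
    by (subst integral_eq_nn_integral) (auto simp: W_def)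
  \<comment> \<open>Nonnegativity of the divergence.\<close>
  have "(\<integral>x. 1 - W x \<partial>?M) \<le> (\<integral>x. exp (- W x) \<partial>?M)"
    using lr(1,2) exp_ge_add_one_self[of "- W _"] by (intro integral_mono) auto
  then have \<kappa>0: "0 \<le> \<kappa>"
    using one lr(1) by (simp add: \<kappa>_def prob_space)
  \<comment> \<open>The moment bound at \<open>-1\<close>, which is in range because \<open>-1\<close> is no larger than \<open>l\<close> in absolute value.\<close>
  have "1 \<le> exp (- \<kappa> + v * g\<^sup>2 / 2)"
    using lr(3) one by (simp add: \<kappa>_def)
  then have \<kappa>w: "\<kappa> \<le> w / 2" using w by simp
  have "l * \<kappa> \<le> \<bar>l\<bar> * \<kappa>" using \<kappa>0 by (intro mult_right_mono) auto
  also have "\<dots> \<le> l\<^sup>2 * (w / 2)"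
  proof -
    have "\<bar>l\<bar> * 1 \<le> \<bar>l\<bar> * \<bar>l\<bar>" using l(1) by (intro mult_left_mono) auto
    then have "\<bar>l\<bar> \<le> l\<^sup>2" by (simp add: power2_eq_square)
    then show ?thesis using \<kappa>0 \<kappa>w by (intro mult_mono) auto
  qed
  finally have "l * \<kappa> + l\<^sup>2 * (v * g\<^sup>2) / 2 \<le> l\<^sup>2 * w"
    using mult_left_mono[OF w, of "l\<^sup>2"] by simp
  then have "(\<integral>x. exp (l * W x) \<partial>?M) \<le> exp (l\<^sup>2 * w)"
    using mgf(3) unfolding \<kappa>_def by (meson exp_le_cancel_iff order_trans)
  then show ?thesis
    using mgf(2) by (subst nn_integral_eq_integral) (auto intro: ennreal_leI)
qed

text \<open>
  An observation contributes only if its design point falls into the cell, which happens with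
  probability at most \<open>1 / d\<close>; the exponent gains this factor, at the cost of \<open>2\<close> from
  linearising the exponential on \<open>[0, 1]\<close>.
\<close>

lemma cell_llr_mgf:
  fixes f f' :: "real \<Rightarrow> real"
  assumes model: "density_family \<mu> p"
    and f: "f \<in> borel_measurable borel" "f' \<in> borel_measurable borel" and h: "h < d"
    and u: "0 \<le> u" "u \<le> 1"
    and mgf: "\<And>t. t \<in> {0..1} \<Longrightarrow>
      (\<integral>\<^sup>+x. ennreal (exp (l * log_lik_ratio p f f' x t)) \<partial>response_law \<mu> p (f t)) \<le> ennreal (exp u)"
  shows "(\<integral>\<^sup>+z. ennreal (exp (l * (indicator (cell d h) (fst z) * log_lik_ratio p f f' (snd z) (fst z))))
    \<partial>obs_law \<mu> p f) \<le> ennreal (exp (2 * u / real d))"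
proof -
  interpret D: prob_space design_law by (rule prob_space_design_law)
  interpret R: prob_space "response_law \<mu> p \<theta>" for \<theta> by (rule prob_space_response_law[OF model])
  note [measurable] = log_lik_ratio_measurable[OF model f]
  have cut: "AE t in design_law.
      (\<integral>\<^sup>+x. ennreal (exp (l * (indicator (cell d h) t * log_lik_ratio p f f' x t))) \<partial>response_law \<mu> p (f t))
      \<le> 1 + ennreal (exp u - 1) * indicator (cell d h) t"
    using AE_design_law
  proof eventually_elim
    case (elim t)
    have "ennreal (exp u) = 1 + ennreal (exp u - 1)"
      using u by (simp flip: ennreal_1 ennreal_plus)
    then show ?case
      using mgf[OF elim] by (cases "t \<in> cell d h") (auto simp: R.emeasure_space_1)
  qed
  have "exp u - 1 \<le> 2 * u"
    using exp_bound[OF u] mult_left_mono[OF u(2) u(1)] by (simp add: power2_eq_square)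
  then have "(exp u - 1) * (1 / real d) \<le> 2 * u * (1 / real d)"
    by (intro mult_right_mono) auto
  then have small: "1 + (exp u - 1) * (1 / real d) \<le> exp (2 * u / real d)"
    using exp_ge_add_one_self[of "2 * u / real d"] unfolding times_divide_eq_right mult_1_right
    by linarith
  have "(\<integral>\<^sup>+z. ennreal (exp (l * (indicator (cell d h) (fst z) * log_lik_ratio p f f' (snd z) (fst z))))
    \<partial>obs_law \<mu> p f)
    = (\<integral>\<^sup>+t. \<integral>\<^sup>+x. ennreal (exp (l * (indicator (cell d h) t * log_lik_ratio p f f' x t)))
      \<partial>response_law \<mu> p (f t) \<partial>design_law)"
    by (subst nn_integral_obs_law[OF model f(1)]) simp_all
  also have "\<dots> \<le> (\<integral>\<^sup>+t. 1 + ennreal (exp u - 1) * indicator (cell d h) t \<partial>design_law)"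
    by (rule nn_integral_mono_AE[OF cut])
  also have "\<dots> = 1 + ennreal (exp u - 1) * emeasure design_law (cell d h)"
    by (subst nn_integral_add) (auto simp: D.emeasure_space_1 nn_integral_cmult_indicator)
  also have "\<dots> \<le> 1 + ennreal (exp u - 1) * ennreal (1 / real d)"
    by (intro add_left_mono mult_left_mono emeasure_cell h) auto
  also have "\<dots> = ennreal (1 + (exp u - 1) * (1 / real d))"
    using u by (simp flip: ennreal_1 ennreal_plus ennreal_mult')
  also have "\<dots> \<le> ennreal (exp (2 * u / real d))"
    using small by (rule ennreal_leI)
  finally show ?thesis .
qed

section \<open>The size of the sieve dimension\<close>

text \<open>
  With \<open>N = n m\<close>, the defining equation gives \<open>n ln N \<le> N_bass \<le> n m ln N\<close>: each summand is at
  most \<open>1\<close>.  The lower bound makes \<open>d\<^bsup>1 + 2 r\<^esup> ln N\<close> eventually exceed \<open>n\<close>.  The upper bound and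
  \<open>m \<le> n\<^sup>\<gamma>\<close> give \<open>d \<le> const * n\<^bsup>(1 + \<gamma>) / (1 + 2 r)\<^esup>\<close> up to logarithms, and \<open>\<gamma> < 2 r\<close> says that
  the exponent is below \<open>1\<close>; hence the mean number \<open>n / d\<close> of
  observations of one machine in a cell is of larger order than \<open>ln N\<close>.
\<close>

lemma dimension_asymptotics:
  fixes r \<gamma> A :: real and m d :: "nat \<Rightarrow> nat" and B :: "nat \<Rightarrow> nat \<Rightarrow> real"
  assumes r: "0 < r" and A: "0 < A"
    and machines: "\<forall>n\<ge>1. 1 \<le> m n" "\<forall>n\<ge>1. real (m n) \<le> real n powr \<gamma>"
    and gamma: "\<gamma> < 2 * r"
    and N_bass: "\<forall>\<^sub>F n in sequentially. solves_N_bass r n (m n) (B n) (N_bass n)"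
    and d_asymp: "(\<lambda>n. real (d n)) \<in> \<Theta>(\<lambda>n. N_bass n powr (1 / (1 + 2 * r)))"
  shows "\<forall>\<^sub>F n in sequentially. 1 \<le> ln (real (n * m n))"
    and "\<forall>\<^sub>F n in sequentially. real n \<le> real (d n) powr (1 + 2 * r) * ln (real (n * m n))"
    and "\<forall>\<^sub>F n in sequentially. A * (real (d n) * ln (real (n * m n))) \<le> real n"
    and "filterlim (\<lambda>n. real (d n)) at_top sequentially"
proof -
  note machines = machines[rule_format]
  define L where "L n = ln (real (n * m n))" for n
  define q where "q = 1 / (1 + 2 * r)"
  have q: "0 < q" "q * (1 + 2 * r) = 1" "(1 + 2 * r) * q = 1" using r by (simp_all add: q_def)
  obtain c2 where c2: "0 < c2" "\<forall>\<^sub>F n in sequentially. norm (real (d n)) \<le> c2 * norm (N_bass n powr q)"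
    using d_asymp unfolding q_def by (auto simp: bigtheta_def elim: landau_o.bigE)
  obtain c1 where c1: "0 < c1" "\<forall>\<^sub>F n in sequentially. norm (real (d n)) \<ge> c1 * norm (N_bass n powr q)"
    using d_asymp unfolding q_def by (auto simp: bigtheta_def elim: landau_omega.bigE)
  have large: "\<forall>\<^sub>F n in sequentially. 1 \<le> n" by (rule eventually_ge_at_top)
  have n_le: "real n \<le> real (n * m n)" if "1 \<le> n" for n
    using machines(1)[OF that] that by simp
  have L_ge: "\<forall>\<^sub>F n in sequentially. ln (real n) \<le> L n"
    using large
  proof eventually_elim
    case (elim n)
    then show ?case
      unfolding L_def using n_le[OF elim] by (subst ln_le_cancel_iff) auto
  qed
  have L_le: "\<forall>\<^sub>F n in sequentially. L n \<le> (1 + \<gamma>) * ln (real n)"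
    using large
  proof eventually_elim
    case (elim n)
    have "L n \<le> ln (real n * real n powr \<gamma>)"
      unfolding L_def using machines[OF elim] elim by (subst ln_le_cancel_iff) auto
    also have "\<dots> = (1 + \<gamma>) * ln (real n)"
      using elim by (simp add: ln_mult ln_powr algebra_simps)
    finally show ?case .
  qed
  have "\<forall>\<^sub>F n in sequentially. 1 \<le> ln (real n)" by real_asymp
  with L_ge show L1: "\<forall>\<^sub>F n in sequentially. 1 \<le> ln (real (n * m n))"
    by eventually_elim (simp add: L_def)
  have lower: "\<forall>\<^sub>F n in sequentially. real n * L n \<le> N_bass n"
    using N_bass by eventually_elim (simp add: solves_N_bass_def L_def max_def split: if_splits)
  have upper: "\<forall>\<^sub>F n in sequentially. N_bass n \<le> real n * (real (m n) * L n)"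
    using N_bass L1 large
  proof eventually_elim
    case (elim n)
    have L: "1 \<le> L n" using elim by (simp add: L_def)
    have "1 \<le> real (m n)" using machines(1)[OF elim(3)] by simp
    then have 1: "L n \<le> real (m n) * L n" using L mult_right_mono[of 1 "real (m n)" "L n"] by simp
    have "(\<Sum>k<m n. min (B n k * L n / N_bass n powr q) 1) \<le> (\<Sum>k<m n. 1)"
      by (intro sum_mono) auto
    also have "\<dots> \<le> real (m n) * L n" using L mult_left_mono[of 1 "L n" "real (m n)"] by simp
    finally have 2: "(\<Sum>k<m n. min (B n k * L n / N_bass n powr q) 1) \<le> real (m n) * L n" .
    show ?case
      using elim(1) mult_left_mono[OF 1, of "real n"] mult_left_mono[OF 2, of "real n"]
      unfolding solves_N_bass_def L_def q_def by simp
  qed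
  have Npos: "\<forall>\<^sub>F n in sequentially. 0 < N_bass n"
    using lower L1 large
  proof eventually_elim
    case (elim n)
    have "0 < real n * L n" using elim by (simp add: L_def)
    then show ?case using elim by linarith
  qed
  have d_ge: "\<forall>\<^sub>F n in sequentially. c1 powr (1 + 2 * r) * (real n * L n) \<le> real (d n) powr (1 + 2 * r)"
    using c1(2) lower Npos
  proof eventually_elim
    case (elim n)
    have "c1 powr (1 + 2 * r) * (real n * L n) \<le> c1 powr (1 + 2 * r) * N_bass n"
      using elim c1 by (intro mult_left_mono) auto
    also have "\<dots> = (c1 * N_bass n powr q) powr (1 + 2 * r)"
      using elim c1 q by (simp add: powr_mult powr_powr)
    also have "\<dots> \<le> real (d n) powr (1 + 2 * r)"
      using elim c1 r by (intro powr_mono2) auto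
    finally show ?case .
  qed
  have c1': "0 < c1 powr (1 + 2 * r)" using c1 by simp
  show "\<forall>\<^sub>F n in sequentially. real n \<le> real (d n) powr (1 + 2 * r) * ln (real (n * m n))"
  proof -
    have "\<forall>\<^sub>F n in sequentially. 1 \<le> c1 powr (1 + 2 * r) * (ln (real n))\<^sup>2"
      using c1' by real_asymp
    with d_ge L1 L_ge large show ?thesis
    proof eventually_elim
      case (elim n)
      have "(ln (real n))\<^sup>2 \<le> (L n)\<^sup>2" using elim by (intro power_mono) auto
      then have "1 \<le> c1 powr (1 + 2 * r) * (L n)\<^sup>2"
        using elim mult_left_mono[OF _ less_imp_le[OF c1']] order_trans by blast
      then have "real n * 1 \<le> real n * (c1 powr (1 + 2 * r) * (L n)\<^sup>2)"
        by (intro mult_left_mono) auto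
      also have "\<dots> = c1 powr (1 + 2 * r) * (real n * L n) * L n"
        by (simp add: power2_eq_square)
      also have "\<dots> \<le> real (d n) powr (1 + 2 * r) * L n"
        using elim by (intro mult_right_mono) (auto simp: L_def)
      finally show ?case by (simp add: L_def)
    qed
  qed
  have "\<gamma> \<ge> 0"
  proof (rule ccontr)
    assume "\<not> 0 \<le> \<gamma>"
    then have "2 powr \<gamma> < (2::real) powr 0" by (intro powr_less_mono) auto
    then show False using machines[of 2] by simp
  qed
  have exponent: "(1 + \<gamma>) * q < 1" using gamma r by (simp add: q_def)
  show "\<forall>\<^sub>F n in sequentially. A * (real (d n) * ln (real (n * m n))) \<le> real n"
  proof -
    have "\<forall>\<^sub>F n in sequentially. A * (c2 * (real n powr ((1 + \<gamma>) * q) * ((1 + \<gamma>) * ln (real n)) powr (q + 1))) \<le> real n"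
      using exponent q \<open>0 \<le> \<gamma>\<close> c2 A by real_asymp
    with c2(2) upper Npos L1 L_le large show ?thesis
    proof eventually_elim
      case (elim n)
      have L: "1 \<le> L n" using elim by (simp add: L_def)
      have "real (d n) \<le> c2 * N_bass n powr q" using elim by simp
      also have "\<dots> \<le> c2 * (real n * (real n powr \<gamma> * L n)) powr q"
      proof -
        have "N_bass n \<le> real n * (real (m n) * L n)" using elim by simp
        also have "\<dots> \<le> real n * (real n powr \<gamma> * L n)"
          using machines(2) elim L by (intro mult_left_mono mult_right_mono) auto
        finally show ?thesis using elim q c2 by (intro mult_left_mono powr_mono2) auto
      qed
      also have "(real n * (real n powr \<gamma> * L n)) powr q = (real n powr (1 + \<gamma>) * L n) powr q"
        using elim by (simp add: powr_add mult_ac)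
      also have "\<dots> = real n powr ((1 + \<gamma>) * q) * L n powr q"
        using L by (simp add: powr_mult powr_powr)
      finally have "real (d n) * L n \<le> (c2 * (real n powr ((1 + \<gamma>) * q) * L n powr q)) * L n"
        using L by (intro mult_right_mono) auto
      also have "\<dots> = c2 * (real n powr ((1 + \<gamma>) * q) * L n powr (q + 1))"
        using L by (simp add: powr_add)
      also have "\<dots> \<le> c2 * (real n powr ((1 + \<gamma>) * q) * ((1 + \<gamma>) * ln (real n)) powr (q + 1))"
        using elim L q c2 by (intro mult_left_mono powr_mono2) auto
      finally have "A * (real (d n) * L n) \<le> A * (c2 * (real n powr ((1 + \<gamma>) * q) * ((1 + \<gamma>) * ln (real n)) powr (q + 1)))"
        using A by (intro mult_left_mono) auto
      then show ?case using elim by (simp add: L_def)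
    qed
  qed
  have "filterlim (\<lambda>n. c1 * (real n * 1) powr q) at_top sequentially"
    using c1 q by real_asymp
  then show "filterlim (\<lambda>n. real (d n)) at_top sequentially"
  proof (rule filterlim_at_top_mono)
    show "\<forall>\<^sub>F n in sequentially. c1 * (real n * 1) powr q \<le> real (d n)"
      using c1(2) lower L1
    proof eventually_elim
      case (elim n)
      have "real n * 1 \<le> real n * L n"
        using elim by (intro mult_left_mono) (auto simp: L_def)
      then have "(real n * 1) powr q \<le> N_bass n powr q"
        using elim q by (intro powr_mono2) auto
      then have "c1 * (real n * 1) powr q \<le> c1 * N_bass n powr q"
        using c1 by (intro mult_left_mono) auto
      then show ?case using elim by simp
    qed
  qed
qed

section \<open>The probability of the good event\<close>

text \<open>
  On a cell the regression function depends only on the sign attached to it, so a pair of sign vectors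
  contributes \<open>0\<close> if the signs agree and \<open>T\<close> or \<open>-T\<close> otherwise, where \<open>T\<close> is the sum for the true
  vector against its opposite.  The maximum over the exponentially many pairs is thus
  the absolute value of a single sum, and no union bound over sign vectors is paid.
\<close>

lemma good_event_eq_abs_le:
  assumes local: "\<And>\<beta> \<beta>' t. t \<in> cell d h \<Longrightarrow> \<beta> h = \<beta>' h \<Longrightarrow> F \<beta> t = F \<beta>' t"
    and h: "h < d" and \<beta>: "\<beta> \<in> sign_vectors d"
  shows "good_event D p F n d h k a = {\<omega> \<in> space D. \<bar>\<Sum>i<n. indicator (cell d h) (fst (\<omega> (k, i)))
    * log_lik_ratio p (F \<beta>) (F (opposite d \<beta>)) (snd (\<omega> (k, i))) (fst (\<omega> (k, i)))\<bar> \<le> a}"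
proof -
  let ?V = "sign_vectors d" and ?\<beta>' = "opposite d \<beta>"
  define T where "T \<beta>\<^sub>1 \<beta>\<^sub>2 \<omega> = (\<Sum>i | i < n \<and> fst (\<omega> (k, i)) \<in> cell d h.
      log_lik_ratio p (F \<beta>\<^sub>1) (F \<beta>\<^sub>2) (snd (\<omega> (k, i))) (fst (\<omega> (k, i))))"
    for \<beta>\<^sub>1 \<beta>\<^sub>2 and \<omega> :: "nat \<times> nat \<Rightarrow> real \<times> _"
  have sign: "\<alpha> h = 1 \<or> \<alpha> h = - 1" if "\<alpha> \<in> ?V" for \<alpha>
    using that h by (auto simp: sign_vectors_def PiE_iff)
  have flip: "?\<beta>' h = - \<beta> h" using h by (simp add: opposite_def)
  have T_cong: "T \<alpha>\<^sub>1 \<alpha>\<^sub>2 \<omega> = T \<alpha>\<^sub>3 \<alpha>\<^sub>4 \<omega>" if "\<alpha>\<^sub>1 h = \<alpha>\<^sub>3 h" "\<alpha>\<^sub>2 h = \<alpha>\<^sub>4 h" for \<alpha>\<^sub>1 \<alpha>\<^sub>2 \<alpha>\<^sub>3 \<alpha>\<^sub>4 \<omega>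
    unfolding T_def using that by (intro sum.cong refl log_lik_ratio_cong local) auto
  have T_swap: "T ?\<beta>' \<beta> \<omega> = - T \<beta> ?\<beta>' \<omega>" for \<omega>
    unfolding T_def sum_negf[symmetric] by (intro sum.cong refl log_lik_ratio_swap)
  have T_same: "T \<alpha>\<^sub>1 \<alpha>\<^sub>2 \<omega> = 0" if "\<alpha>\<^sub>1 h = \<alpha>\<^sub>2 h" for \<alpha>\<^sub>1 \<alpha>\<^sub>2 \<omega>
    unfolding T_def using that by (intro sum.neutral ballI log_lik_ratio_self local) auto
  have T_cases: "T \<alpha>\<^sub>1 \<alpha>\<^sub>2 \<omega> \<in> {0, T \<beta> ?\<beta>' \<omega>, - T \<beta> ?\<beta>' \<omega>}" if \<alpha>: "\<alpha>\<^sub>1 \<in> ?V" "\<alpha>\<^sub>2 \<in> ?V" for \<alpha>\<^sub>1 \<alpha>\<^sub>2 \<omega>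
  proof -
    consider "\<alpha>\<^sub>1 h = \<alpha>\<^sub>2 h" | "\<alpha>\<^sub>1 h = \<beta> h" "\<alpha>\<^sub>2 h = ?\<beta>' h" | "\<alpha>\<^sub>1 h = ?\<beta>' h" "\<alpha>\<^sub>2 h = \<beta> h"
      using sign[OF \<alpha>(1)] sign[OF \<alpha>(2)] sign[OF \<beta>] flip by fastforce
    then show ?thesis
      by cases (use T_same T_cong T_swap in \<open>metis insertI1 insertI2\<close>)+
  qed
  have max_iff: "(MAX (\<beta>, \<beta>')\<in>?V \<times> ?V. T \<beta> \<beta>' \<omega>) \<le> a \<longleftrightarrow> \<bar>T \<beta> ?\<beta>' \<omega>\<bar> \<le> a" for \<omega>
  proof -
    have "(MAX (\<beta>, \<beta>')\<in>?V \<times> ?V. T \<beta> \<beta>' \<omega>) \<le> a \<longleftrightarrow> (\<forall>(\<beta>, \<beta>')\<in>?V \<times> ?V. T \<beta> \<beta>' \<omega> \<le> a)"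
      using \<beta> by (subst Max_le_iff) (auto simp: finite_sign_vectors)
    also have "\<dots> \<longleftrightarrow> \<bar>T \<beta> ?\<beta>' \<omega>\<bar> \<le> a"
    proof
      assume le: "\<forall>(\<beta>, \<beta>')\<in>?V \<times> ?V. T \<beta> \<beta>' \<omega> \<le> a"
      have "T \<beta> ?\<beta>' \<omega> \<le> a" "T ?\<beta>' \<beta> \<omega> \<le> a"
        using le \<beta> opposite_sign_vectors[OF \<beta>] by auto
      then show "\<bar>T \<beta> ?\<beta>' \<omega>\<bar> \<le> a" unfolding T_swap by linarith
    next
      assume le: "\<bar>T \<beta> ?\<beta>' \<omega>\<bar> \<le> a"
      have "T \<alpha>\<^sub>1 \<alpha>\<^sub>2 \<omega> \<le> a" if "\<alpha>\<^sub>1 \<in> ?V" "\<alpha>\<^sub>2 \<in> ?V" for \<alpha>\<^sub>1 \<alpha>\<^sub>2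
        using T_cases[OF that, of \<omega>] le by auto
      then show "\<forall>(\<beta>, \<beta>')\<in>?V \<times> ?V. T \<beta> \<beta>' \<omega> \<le> a" by auto
    qed
    finally show ?thesis .
  qed
  have T_sum: "T \<beta> ?\<beta>' \<omega> = (\<Sum>i<n. indicator (cell d h) (fst (\<omega> (k, i)))
    * log_lik_ratio p (F \<beta>) (F ?\<beta>') (snd (\<omega> (k, i))) (fst (\<omega> (k, i))))" for \<omega>
  proof -
    have "{i. i < n \<and> fst (\<omega> (k, i)) \<in> cell d h} = {..<n} \<inter> {i. fst (\<omega> (k, i)) \<in> cell d h}"
      by auto
    then show ?thesis
      unfolding T_def by (auto simp: sum.inter_restrict indicator_def intro!: sum.cong)
  qed
  show ?thesis
    using max_iff unfolding good_event_def T_sum unfolding T_def by simp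
qed

lemma good_event_probability:
  assumes model: "density_family \<mu> p"
    and F: "\<And>\<beta>. F \<beta> \<in> borel_measurable borel"
    and local: "\<And>\<beta> \<beta>' t. t \<in> cell d h \<Longrightarrow> \<beta> h = \<beta>' h \<Longrightarrow> F \<beta> t = F \<beta>' t"
    and h: "h < d" and k: "k < m" and \<beta>: "\<beta> \<in> sign_vectors d"
    and l: "0 < l" and u: "0 \<le> u" "u \<le> 1"
    and mgf: "\<And>t l'. t \<in> {0..1} \<Longrightarrow> l' \<in> {l, - l} \<Longrightarrow>
      (\<integral>\<^sup>+x. ennreal (exp (l' * log_lik_ratio p (F \<beta>) (F (opposite d \<beta>)) x t))
        \<partial>response_law \<mu> p (F \<beta> t)) \<le> ennreal (exp u)"
  shows "\<bar>measure (data_law n m \<mu> p (F \<beta>))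
      (good_event (data_law n m \<mu> p (F \<beta>)) p F n d h k a) - 1\<bar>
    \<le> 2 * exp (real n * (2 * u / real d) - l * a)"
proof -
  let ?D = "data_law n m \<mu> p (F \<beta>)"
  define Y where "Y z = indicator (cell d h) (fst z)
    * log_lik_ratio p (F \<beta>) (F (opposite d \<beta>)) (snd z) (fst z)" for z :: "real \<times> 'a"
  define Z where "Z \<omega> = (\<Sum>i<n. Y (\<omega> (k, i)))" for \<omega> :: "nat \<times> nat \<Rightarrow> real \<times> 'a"
  interpret D: prob_space ?D
    unfolding data_law_def by (intro prob_space_PiM prob_space_obs_law model F)
  have Y [measurable]: "Y \<in> borel_measurable (borel \<Otimes>\<^sub>M \<mu>)"
    unfolding Y_def by (intro borel_measurable_times log_lik_ratio_measurable model F) measurable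
  have mgfY: "(\<integral>\<^sup>+z. ennreal (exp (l' * Y z)) \<partial>obs_law \<mu> p (F \<beta>)) \<le> ennreal (exp (2 * u / real d))"
    if "l' \<in> {l, - l}" for l'
    unfolding Y_def using that by (intro cell_llr_mgf model F h u mgf)
  have Z [measurable]: "Z \<in> borel_measurable ?D"
    unfolding Z_def by (rule data_law_sum_measurable[OF Y k])
  have upper: "measure ?D {\<omega> \<in> space ?D. a < Z \<omega>} \<le> exp (real n * (2 * u / real d) - l * a)"
    unfolding Z_def using mgfY[of l] by (intro chernoff_data_law model F Y l k) auto
  have "measure ?D {\<omega> \<in> space ?D. a < (\<Sum>i<n. - Y (\<omega> (k, i)))}
      \<le> exp (real n * (2 * u / real d) - l * a)"
    using mgfY[of "- l"] by (intro chernoff_data_law model F l k) auto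
  then have lower: "measure ?D {\<omega> \<in> space ?D. a < - Z \<omega>} \<le> exp (real n * (2 * u / real d) - l * a)"
    by (simp add: Z_def sum_negf)
  have good: "good_event ?D p F n d h k a = {\<omega> \<in> space ?D. \<bar>Z \<omega>\<bar> \<le> a}"
    unfolding Z_def Y_def by (rule good_event_eq_abs_le[OF _ h \<beta>]) (rule local)
  have "1 - measure ?D (good_event ?D p F n d h k a)
      = measure ?D (space ?D - good_event ?D p F n d h k a)"
    unfolding good using Z by (subst D.prob_compl) auto
  also have "space ?D - good_event ?D p F n d h k a
      = {\<omega> \<in> space ?D. a < Z \<omega>} \<union> {\<omega> \<in> space ?D. a < - Z \<omega>}"
    unfolding good by auto
  also have "measure ?D \<dots> \<le> measure ?D {\<omega> \<in> space ?D. a < Z \<omega>} + measure ?D {\<omega> \<in> space ?D. a < - Z \<omega>}"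
    by (intro measure_Un_le) measurable
  finally show ?thesis
    using upper lower D.prob_le_1[of "good_event ?D p F n d h k a"] by linarith
qed

theorem lemma1:
  fixes r \<gamma> \<epsilon> C\<^sub>0 c c\<^sub>1 K :: real
    and S :: nat
    and \<mu> :: "'x measure" and p :: "'x \<Rightarrow> real \<Rightarrow> real"
    and m d j :: "nat \<Rightarrow> nat"
    and B :: "nat \<Rightarrow> nat \<Rightarrow> real" and N_bass :: "nat \<Rightarrow> real"
    and \<Psi> :: "nat \<Rightarrow> nat \<Rightarrow> real \<Rightarrow> real" and \<sigma> :: "nat \<Rightarrow> nat \<Rightarrow> nat"
    and F :: "nat \<Rightarrow> (nat \<Rightarrow> real) \<Rightarrow> real \<Rightarrow> real"
    and g\<^sub>1 g\<^sub>2 \<nu> b :: "nat \<Rightarrow> (nat \<Rightarrow> real) \<Rightarrow> real \<Rightarrow> real"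
    and stat :: "nat \<Rightarrow> (nat \<Rightarrow> real) \<Rightarrow> 'x \<Rightarrow> real"
  assumes r: "0 < r" and eps: "0 < \<epsilon>"
    and machines: "\<And>n. 1 \<le> n \<Longrightarrow> 1 \<le> m n" "\<And>n. 1 \<le> n \<Longrightarrow> real (m n) \<le> real n powr \<gamma>"
    and gamma: "\<gamma> < 2 * r"
    and budgets: "\<And>n k. k < m n \<Longrightarrow> 0 \<le> B n k"
    and N_bass: "\<forall>\<^sub>F n in sequentially. solves_N_bass r n (m n) (B n) (N_bass n)"
    and c: "0 < c" "c < 1"
    and d_eq: "\<And>n. real (d n) = c * 2 ^ j n"
    and d_asymp: "(\<lambda>n. real (d n)) \<in> \<Theta>(\<lambda>n. N_bass n powr (1 / (1 + 2 * r)))"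
    and wavelets: "r < real S" "boundary_daubechies_wavelets S \<Psi>"
    and wavelet_in_cell: "\<forall>\<^sub>F n in sequentially. \<forall>h<d n.
          \<sigma> n h < 2 ^ j n \<and> {t. \<Psi> (j n) (\<sigma> n h) t \<noteq> 0} \<subseteq> cell (d n) h"
    and F: "\<And>n \<beta> t. F n \<beta> t = sieve r \<epsilon> (d n) (\<lambda>h. \<Psi> (j n) (\<sigma> n h)) \<beta> t + C\<^sub>0"
    and model: "density_family \<mu> p"
    and llr_form: "\<forall>\<^sub>F n in sequentially. \<forall>\<beta>\<in>sign_vectors (d n). \<forall>t\<in>{0..1}.
          AE x in response_law \<mu> p (F n \<beta> t).
            0 < p x (F n (opposite (d n) \<beta>) t) \<and>
            log_lik_ratio p (F n \<beta>) (F n (opposite (d n) \<beta>)) x t = g\<^sub>1 n \<beta> t * stat n \<beta> x - g\<^sub>2 n \<beta> t"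
    and sub_exp: "\<forall>\<^sub>F n in sequentially. \<forall>\<beta>\<in>sign_vectors (d n). \<forall>t\<in>{0..1}.
          sub_exponential (response_law \<mu> p (F n \<beta> t)) (stat n \<beta>) ((\<nu> n \<beta> t)\<^sup>2) (b n \<beta> t)"
    and oscillation: "\<forall>\<^sub>F n in sequentially. \<forall>\<beta>\<in>sign_vectors (d n). \<forall>s\<in>{0..1}. \<forall>t\<in>{0..1}.
          cond_mean_llr \<mu> p (F n \<beta>) (F n (opposite (d n) \<beta>)) s
            - cond_mean_llr \<mu> p (F n \<beta>) (F n (opposite (d n) \<beta>)) t \<le> K * real (d n) powr (- r)"
    and variance_proxy: "\<forall>\<^sub>F n in sequentially. \<forall>\<beta>\<in>sign_vectors (d n). \<forall>t\<in>{0..1}.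
          (\<nu> n \<beta> t)\<^sup>2 * (g\<^sub>1 n \<beta> t)\<^sup>2 \<le> K * real (d n) powr (- 2 * r)"
    and scale: "\<forall>\<^sub>F n in sequentially. \<forall>\<beta>\<in>sign_vectors (d n). \<forall>t\<in>{0..1}.
          \<bar>g\<^sub>1 n \<beta> t\<bar> * b n \<beta> t \<le> K * real (d n) powr (- r)"
    and mean: "\<forall>\<^sub>F n in sequentially. \<forall>\<beta>\<in>sign_vectors (d n).
          integrable (obs_law \<mu> p (F n \<beta>))
            (\<lambda>(t, x). log_lik_ratio p (F n \<beta>) (F n (opposite (d n) \<beta>)) x t) \<and>
          \<bar>\<integral>(t, x). log_lik_ratio p (F n \<beta>) (F n (opposite (d n) \<beta>)) x t \<partial>obs_law \<mu> p (F n \<beta>)\<bar>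
            \<le> K * real (d n) powr (- 2 * r)"
    and c1: "0 < c\<^sub>1"
    and lower: "\<forall>\<^sub>F n in sequentially. \<forall>\<beta>\<in>sign_vectors (d n). \<forall>h<d n.
          c\<^sub>1 * real (d n) powr (- 1 - 2 * r)
            \<le> (\<integral>t. (\<nu> n \<beta> t)\<^sup>2 * (g\<^sub>1 n \<beta> t)\<^sup>2 * indicator (cell (d n) h) t \<partial>design_law)"
  shows "\<exists>C>0. \<exists>R. R \<in> o(\<lambda>n. 1 / (real (m n) ^ 2 * real (d n) ^ 2)) \<and>
    (\<forall>\<^sub>F n in sequentially. \<forall>h<d n. \<forall>k<m n. \<forall>\<beta>\<in>sign_vectors (d n).
       \<bar>measure (data_law n (m n) \<mu> p (F n \<beta>))
          (good_event (data_law n (m n) \<mu> p (F n \<beta>)) p (F n) n (d n) h k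
             (C * \<epsilon> * real (d n) powr (- 1 / 2 - r) * sqrt (real n * ln (real (n * m n))))) - 1\<bar>
         \<le> R n)"
proof -
  \<comment> \<open>\<open>A \<ge> 1\<close> replaces the constant \<open>K\<close>, whose sign is not prescribed.\<close>
  define A where "A = max K 1"
  have A: "1 \<le> A" "K \<le> A" by (auto simp: A_def)
  \<comment> \<open>The quadratic term costs \<open>2 A ln N\<close>; the remaining \<open>3 ln N\<close> is the tail exponent.\<close>
  define C where "C = (2 * A + 3) / \<epsilon>"
  define L where "L n = ln (real (n * m n))" for n
  define R where "R n = 2 * exp (- 3 * L n)" for n
  have A2: "0 < A\<^sup>2" using A by simp
  have ms: "\<forall>n\<ge>1. 1 \<le> m n" "\<forall>n\<ge>1. real (m n) \<le> real n powr \<gamma>"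
    using machines by auto
  note dims = dimension_asymptotics[OF r A2 ms gamma N_bass d_asymp, folded L_def]
  have level: "\<forall>\<^sub>F n in sequentially. 4 * S \<le> 2 ^ j n"
  proof -
    have "\<forall>\<^sub>F n in sequentially. real (4 * S) \<le> real (d n)"
      using dims(4) by (simp only: filterlim_at_top)
    then show ?thesis
    proof eventually_elim
      case (elim n)
      have "real (4 * S) \<le> c * 2 ^ j n" using elim by (simp only: d_eq)
      also have "\<dots> \<le> 1 * 2 ^ j n" using c by (intro mult_right_mono) auto
      finally have "real (4 * S) \<le> real (2 ^ j n)" by simp
      then show ?case by (simp only: of_nat_le_iff)
    qed
  qed
  \<comment> \<open>Both tails together are \<open>2 / N ^ 3\<close>, while \<open>m d \<le> m n = N\<close> eventually.\<close>
  have "R \<in> o(\<lambda>n. 1 / (real (m n) ^ 2 * real (d n) ^ 2))"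
  proof (rule landau_o.smallI)
    fix e :: real assume e: "0 < e"
    have "\<forall>\<^sub>F n in sequentially. 2 / real n \<le> e" using e by real_asymp
    with dims(1,3) eventually_gt_at_top[of 0]
    show "\<forall>\<^sub>F n in sequentially. norm (R n) \<le> e * norm (1 / (real (m n) ^ 2 * real (d n) ^ 2))"
    proof eventually_elim
      case (elim n)
      define N where "N = real (n * m n)"
      have m: "1 \<le> real (m n)" using machines(1)[of n] elim by simp
      then have N: "real n \<le> N" "0 < N" using elim by (auto simp: N_def)
      have d: "0 < real (d n)" using d_eq[of n] c by simp
      have "1 * (real (d n) * 1) \<le> A\<^sup>2 * (real (d n) * L n)"
        using A elim by (intro mult_mono) auto
      then have "real (d n) \<le> real n" using elim by simp
      then have "real (m n) * real (d n) \<le> N"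
        using mult_right_mono[of "real (d n)" "real n" "real (m n)"] by (simp add: N_def mult.commute)
      then have "(real (m n) * real (d n))\<^sup>2 \<le> N\<^sup>2" using d m by (intro power_mono) auto
      then have "2 / N ^ 3 * (real (m n) * real (d n))\<^sup>2 \<le> 2 / N ^ 3 * N\<^sup>2"
        using N by (intro mult_left_mono) auto
      also have "\<dots> = 2 / N" using N by (simp add: field_simps power2_eq_square power3_eq_cube)
      also have "\<dots> \<le> 2 / real n" using N elim by (intro divide_left_mono) auto
      also have "\<dots> \<le> e" by (rule elim)
      finally have "2 / N ^ 3 \<le> e / (real (m n) * real (d n))\<^sup>2"
        using d m by (simp add: pos_le_divide_eq)
      moreover have "R n = 2 / N ^ 3"
      proof -
        have "L n = ln N" by (simp only: L_def N_def)
        then show ?thesis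
          using N exp_of_nat_mult[of 3 "ln N"] by (simp add: R_def exp_minus divide_inverse)
      qed
      ultimately show ?case
        using N by (simp add: power_mult_distrib)
    qed
  qed
  moreover have "\<forall>\<^sub>F n in sequentially. \<forall>h<d n. \<forall>k<m n. \<forall>\<beta>\<in>sign_vectors (d n).
       \<bar>measure (data_law n (m n) \<mu> p (F n \<beta>))
          (good_event (data_law n (m n) \<mu> p (F n \<beta>)) p (F n) n (d n) h k
             (C * \<epsilon> * real (d n) powr (- 1 / 2 - r) * sqrt (real n * L n))) - 1\<bar>
         \<le> R n"
    using dims(1-3) eventually_gt_at_top[of 0] level wavelet_in_cell llr_form sub_exp
      variance_proxy scale
  proof eventually_elim
    case (elim n)
    note L = elim(1) and n = elim(4)
    show ?case
    proof (intro allI impI ballI)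
      fix h k \<beta> assume h: "h < d n" and k: "k < m n" and \<beta>: "\<beta> \<in> sign_vectors (d n)"
      let ?x = "real (d n)" and ?\<beta>' = "opposite (d n) \<beta>"
      have x: "0 < ?x" using h by simp
      \<comment> \<open>The Chernoff parameter at which the linear term \<open>l a\<close> and the quadratic term
        \<open>n l\<^sup>2 d\<^bsup>- 1 - 2 r\<^esup>\<close> are both proportional to \<open>ln N\<close>; \<open>u\<close> is the exponent at one design point.\<close>
      define l where "l = ?x powr (1 / 2 + r) * sqrt (L n / real n)"
      define u where "u = A * (?x * L n / real n)"
      have l0: "0 < l" using x L n by (simp add: l_def)
      have powr_sq: "(?x powr e)\<^sup>2 = ?x powr (2 * e)" for e
        by (simp add: power2_eq_square powr_add[symmetric])
      have l2: "l\<^sup>2 = ?x powr (1 + 2 * r) * L n / real n"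
        using L n by (simp add: l_def power_mult_distrib powr_sq distrib_left)
      have "1 \<le> l\<^sup>2" unfolding l2 using elim(2) n by simp
      then have l1: "1 \<le> l" using l0 power2_le_imp_le[of 1 l] by simp
      have small: "A\<^sup>2 * (?x * L n / real n) \<le> 1" using elim(3) n by simp
      have lr: "(l * ?x powr (- r))\<^sup>2 = ?x * L n / real n"
        using x powr_add[of ?x "1 + 2 * r" "- (2 * r)"]
        by (simp add: power_mult_distrib l2 powr_sq)
      have "(l * (A * ?x powr (- r)))\<^sup>2 = A\<^sup>2 * (l * ?x powr (- r))\<^sup>2"
        by (simp add: power_mult_distrib)
      also have "\<dots> \<le> 1" using small unfolding lr .
      finally have lA: "l * (A * ?x powr (- r)) \<le> 1"
        using power2_le_imp_le[of "l * (A * ?x powr (- r))" 1] by simp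
      have lu: "l\<^sup>2 * (A * ?x powr (- 2 * r)) = u"
        using x powr_add[of ?x "1 + 2 * r" "- (2 * r)"] by (simp add: u_def l2)
      have u0: "0 \<le> u" using A L by (simp add: u_def)
      have "A \<le> A\<^sup>2" using A by (simp add: power2_eq_square)
      then have "u \<le> A\<^sup>2 * (?x * L n / real n)"
        unfolding u_def using L by (intro mult_right_mono) auto
      then have u1: "u \<le> 1" using small by simp
      have Fm: "F n \<alpha> \<in> borel_measurable borel" for \<alpha>
      proof -
        have "sieve r \<epsilon> (d n) (\<lambda>h. \<Psi> (j n) (\<sigma> n h)) \<alpha> \<in> borel_measurable borel"
          using elim(5,6) by (intro sieve_measurable boundary_wavelet_measurable[OF wavelets(2)]) auto
        then have "(\<lambda>t. sieve r \<epsilon> (d n) (\<lambda>h. \<Psi> (j n) (\<sigma> n h)) \<alpha> t + C\<^sub>0) \<in> borel_measurable borel"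
          by measurable
        then show ?thesis by (simp add: F[abs_def] fun_eq_iff cong: measurable_cong)
      qed
      have local: "F n \<alpha> t = F n \<alpha>' t" if "t \<in> cell (d n) h" "\<alpha> h = \<alpha>' h" for \<alpha> \<alpha>' t
        using that sieve_on_cell[of "d n" "\<lambda>h. \<Psi> (j n) (\<sigma> n h)" h t] elim(6) h by (simp add: F)
      have mgf: "(\<integral>\<^sup>+x. ennreal (exp (l' * log_lik_ratio p (F n \<beta>) (F n ?\<beta>') x t))
          \<partial>response_law \<mu> p (F n \<beta> t)) \<le> ennreal (exp u)"
        if t: "t \<in> {0..1}" and l': "l' \<in> {l, - l}" for t l'
      proof -
        let ?W = "\<lambda>x. ln (p x (F n \<beta> t) / p x (F n ?\<beta>' t))"
        have \<beta>': "?\<beta>' \<in> sign_vectors (d n)" by (rule opposite_sign_vectors[OF \<beta>])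
        have ac: "AE x in response_law \<mu> p (F n \<beta> t). 0 < p x (F n ?\<beta>' t)"
          and form: "AE x in response_law \<mu> p (F n \<beta> t). ?W x = g\<^sub>1 n \<beta> t * stat n \<beta> x - g\<^sub>2 n \<beta> t"
          using bspec[OF bspec[OF elim(7) \<beta>] t] by (auto simp: log_lik_ratio_def)
        \<comment> \<open>The representation for the opposite vector supplies the reverse absolute continuity.\<close>
        have ac': "AE x in response_law \<mu> p (F n ?\<beta>' t). 0 < p x (F n \<beta> t)"
          using bspec[OF bspec[OF elim(7) \<beta>'] t] by (simp add: opposite_opposite[OF \<beta>])
        have X: "sub_exponential (response_law \<mu> p (F n \<beta> t)) (stat n \<beta>) ((\<nu> n \<beta> t)\<^sup>2) (b n \<beta> t)"
          using elim(8) \<beta> t by blast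
        have "K * ?x powr (- 2 * r) \<le> A * ?x powr (- 2 * r)" "K * ?x powr (- r) \<le> A * ?x powr (- r)"
          using A by (auto intro!: mult_right_mono)
        then have v: "(\<nu> n \<beta> t)\<^sup>2 * (g\<^sub>1 n \<beta> t)\<^sup>2 \<le> A * ?x powr (- 2 * r)"
          and gb: "\<bar>g\<^sub>1 n \<beta> t\<bar> * b n \<beta> t \<le> A * ?x powr (- r)"
          using elim(9,10) \<beta> t by (meson order_trans)+
        have abs_l': "\<bar>l'\<bar> = l" and sq: "l'\<^sup>2 = l\<^sup>2" using l' l0 by auto
        have "l * (\<bar>g\<^sub>1 n \<beta> t\<bar> * b n \<beta> t) \<le> l * (A * ?x powr (- r))"
          using gb l0 by (intro mult_left_mono) auto
        then have range: "\<bar>l'\<bar> * (\<bar>g\<^sub>1 n \<beta> t\<bar> * b n \<beta> t) \<le> 1" using lA abs_l' by simp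
        have "1 \<le> \<bar>l'\<bar>" using l1 abs_l' by simp
        from log_ratio_mgf[OF model ac ac' X form v this range] show ?thesis
          unfolding sq lu log_lik_ratio_def .
      qed
      let ?a = "C * \<epsilon> * ?x powr (- 1 / 2 - r) * sqrt (real n * L n)"
      have "l * ?a = C * \<epsilon> * (?x powr (1 / 2 + r) * ?x powr (- 1 / 2 - r))
          * (sqrt (L n / real n) * sqrt (real n * L n))"
        by (simp add: l_def)
      also have "?x powr (1 / 2 + r) * ?x powr (- 1 / 2 - r) = 1"
        using x by (simp add: powr_add[symmetric])
      also have "sqrt (L n / real n) * sqrt (real n * L n) = L n"
        using n L by (simp add: real_sqrt_mult[symmetric])
      finally have la: "l * ?a = (2 * A + 3) * L n" using eps by (simp add: C_def)
      have nu: "real n * (2 * u / ?x) = 2 * A * L n"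
        using x n by (simp add: u_def)
      have "real n * (2 * u / ?x) - l * ?a = - 3 * L n"
        unfolding la nu by (simp add: algebra_simps)
      moreover have "\<bar>measure (data_law n (m n) \<mu> p (F n \<beta>))
          (good_event (data_law n (m n) \<mu> p (F n \<beta>)) p (F n) n (d n) h k ?a) - 1\<bar>
        \<le> 2 * exp (real n * (2 * u / ?x) - l * ?a)"
        by (rule good_event_probability[OF model Fm _ h k \<beta> l0 u0 u1])
          (rule local mgf; assumption)+
      ultimately show "\<bar>measure (data_law n (m n) \<mu> p (F n \<beta>))
          (good_event (data_law n (m n) \<mu> p (F n \<beta>)) p (F n) n (d n) h k ?a) - 1\<bar> \<le> R n"
        by (simp only: R_def)
    qed
  qed
  moreover have "0 < C" using A eps by (simp add: C_def)
  ultimately show ?thesis unfolding L_def by blast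
qed

end
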